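(* Let $\Omega_1=\{0,1\}^{\mathbb N\times\mathbb N}$ with evaluation set $\Lambda_{\mathrm{mat}}=\{A\mapsto A(i,j):(i,j)\in\mathbb N^2\}$, and for $m\ge1$ let $\Xi_m:\Omega_1\to\{0,1\}$ be as defined below. Then for every $m\ge1$, $\Xi_m\notin\Delta^G_{m-1}$, i.e. $\mathrm{SCI}_G(\Xi_m,\Omega_1,\{0,1\},\Lambda_{\mathrm{mat}})\ge m$; moreover $\mathrm{SCI}_G(\Xi_m,\Omega_1,\{0,1\},\Lambda_{\mathrm{mat}})=m$.
   Context: For each $m\ge1$ fix a bijection $\beta_m:\mathbb N^m\to\mathbb N\times\mathbb N$, $\beta_m(n_1,\dots,n_m)=(i(n_1,\dots,n_m),j(n_1,\dots,n_m))$, and set $P_m(A;n_1,\dots,n_m)=a_{i(n_1,\dots,n_m),j(n_1,\dots,n_m)}$ for $A=(a_{i,j})\in\Omega_1$. Let $Q_1=\exists,Q_2=\forall,Q_3=\exists,\dots$ alternate. Then $\Xi_m(A)=1$ iff $(Q_1n_1)(Q_2n_2)\cdots(Q_mn_m)[P_m(A;n_1,\dots,n_m)=1]$. $\{0,1\}$ carries the discrete metric. A general algorithm is a map $\Gamma:\Omega_1\to\{0,1\}$ such that for each $A$ there is a finite nonempty $\Lambda_\Gamma(A)\subset\Lambda_{\mathrm{mat}}$ with $\Gamma(A)$ depending only on $\{f(A):f\in\Lambda_\Gamma(A)\}$, and with $\Lambda_\Gamma(B)=\Lambda_\Gamma(A)$ whenever $f(B)=f(A)$ for all $f\in\Lambda_\Gamma(A)$.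 A tower of height $k$ is a family of general algorithms $\Gamma_{n_k,\dots,n_1}$ whose iterated pointwise limits $\lim_{n_k}\cdots\lim_{n_1}$ exist at every stage and equal $\Xi$. $\mathrm{SCI}_G$ is the minimal such height ($0$ if $\Xi$ is a general algorithm); $\Delta^G_k$ is the class of problems with $\mathrm{SCI}_G\le k$. *)

theory Defs
  imports "HOL-Analysis.Analysis" "HOL-Library.Extended_Nat"
begin

text \<open>
  A computational problem consists of a map \<open>\<Xi>\<close> from a set \<open>\<Omega>\<close> into a metric space \<open>M\<close> and
  an evaluation set \<open>\<Lambda>\<close> of functions on \<open>\<Omega>\<close>. Only the behaviour of \<open>\<Xi>\<close> and of \<open>\<Lambda>\<close> on \<open>\<Omega>\<close>
  is relevant.
\<close>

definition general_algorithm ::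
  "'a set \<Rightarrow> 'b metric \<Rightarrow> ('a \<Rightarrow> 'v) set \<Rightarrow> ('a \<Rightarrow> 'b) \<Rightarrow> bool" where
  "general_algorithm \<Omega> M \<Lambda> \<Gamma> \<longleftrightarrow>
     (\<forall>A\<in>\<Omega>. \<Gamma> A \<in> mspace M) \<and>
     (\<exists>L :: 'a \<Rightarrow> ('a \<Rightarrow> 'v) set. \<forall>A\<in>\<Omega>.
        finite (L A) \<and> L A \<noteq> {} \<and> L A \<subseteq> \<Lambda> \<and>
        (\<forall>B\<in>\<Omega>. (\<forall>f\<in>L A. f B = f A) \<longrightarrow> \<Gamma> B = \<Gamma> A) \<and>
        (\<forall>B\<in>\<Omega>. (\<forall>f\<in>L A. f B = f A) \<longrightarrow> L B = L A))"

text \<open>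
  The subscripts \<open>n\<^sub>k, \<dots>, n\<^sub>1\<close> of a tower form a list, outermost limit index first. Lists of
  length \<open>k\<close> index the general algorithms; a shorter list \<open>[n\<^sub>k, \<dots>, n\<^sub>j]\<close> indexes the intermediate
  map obtained after the limits over \<open>n\<^sub>1, \<dots>, n\<^sub>j\<^sub>-\<^sub>1\<close> have been taken, and the empty list indexes
  the final limit. For \<open>k = 0\<close> the predicate says that \<open>\<Xi>\<close> itself is a general algorithm.
\<close>

definition tower ::
  "('a \<Rightarrow> 'b) \<Rightarrow> 'a set \<Rightarrow> 'b metric \<Rightarrow> ('a \<Rightarrow> 'v) set \<Rightarrow> nat \<Rightarrow> (nat list \<Rightarrow> 'a \<Rightarrow> 'b) \<Rightarrow> bool" where
  "tower \<Xi> \<Omega> M \<Lambda> k \<Gamma> \<longleftrightarrow>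
     (\<forall>ns. length ns = k \<longrightarrow> general_algorithm \<Omega> M \<Lambda> (\<Gamma> ns)) \<and>
     (\<forall>ns. length ns < k \<longrightarrow>
        (\<forall>A\<in>\<Omega>. limitin (mtopology_of M) (\<lambda>n. \<Gamma> (ns @ [n]) A) (\<Gamma> ns A) sequentially)) \<and>
     (\<forall>A\<in>\<Omega>. \<Gamma> [] A = \<Xi> A)"

text \<open>The infimum over the empty set is \<open>\<infinity>\<close>: this is the case in which no tower exists.\<close>

definition SCI_G :: "('a \<Rightarrow> 'b) \<Rightarrow> 'a set \<Rightarrow> 'b metric \<Rightarrow> ('a \<Rightarrow> 'v) set \<Rightarrow> enat" where
  "SCI_G \<Xi> \<Omega> M \<Lambda> = Inf {enat k | k. \<exists>\<Gamma>. tower \<Xi> \<Omega> M \<Lambda> k \<Gamma>}"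

text \<open>The index is not shifted: \<open>\<Delta>\<^sup>G\<^sub>k\<close> is the class given by \<open>SCI\<^sub>G \<le> k\<close>.\<close>

definition Delta_G ::
  "nat \<Rightarrow> (('a \<Rightarrow> 'b) \<times> 'a set \<times> 'b metric \<times> ('a \<Rightarrow> 'v) set) set" where
  "Delta_G k = {(\<Xi>, \<Omega>, M, \<Lambda>). SCI_G \<Xi> \<Omega> M \<Lambda> \<le> enat k}"

definition Omega1 :: "(nat \<times> nat \<Rightarrow> nat) set" where
  "Omega1 = UNIV \<rightarrow> {0, 1}"

definition Lambda_mat :: "((nat \<times> nat \<Rightarrow> nat) \<Rightarrow> nat) set" where
  "Lambda_mat = {(\<lambda>A. A (i, j)) | i j. True}"

definition discrete01 :: "nat metric" where
  "discrete01 = metric ({0, 1}, discrete_metric.dd)"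

definition Q :: "nat \<Rightarrow> (nat \<Rightarrow> bool) \<Rightarrow> bool" where
  "Q k = (if odd k then Ex else All)"

text \<open>
  \<open>quantified k m P\<close> is \<open>(Q\<^sub>k n\<^sub>k) (Q\<^sub>k\<^sub>+\<^sub>1 n\<^sub>k\<^sub>+\<^sub>1) \<dots> (Q\<^sub>k\<^sub>+\<^sub>m\<^sub>-\<^sub>1 n\<^sub>k\<^sub>+\<^sub>m\<^sub>-\<^sub>1). P [n\<^sub>k, \<dots>, n\<^sub>k\<^sub>+\<^sub>m\<^sub>-\<^sub>1]\<close>.
\<close>

primrec quantified :: "nat \<Rightarrow> nat \<Rightarrow> (nat list \<Rightarrow> bool) \<Rightarrow> bool" where
  "quantified k 0 P = P []"
| "quantified k (Suc m) P = Q k (\<lambda>n. quantified (Suc k) m (\<lambda>ns. P (n # ns)))"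

text \<open>Elements of \<open>\<nat>\<^sup>m\<close> are lists of length \<open>m\<close>; \<open>\<beta> m\<close> matters only on those lists.\<close>

definition Xi :: "(nat \<Rightarrow> nat list \<Rightarrow> nat \<times> nat) \<Rightarrow> nat \<Rightarrow> (nat \<times> nat \<Rightarrow> nat) \<Rightarrow> nat" where
  "Xi \<beta> m A = (if quantified 1 m (\<lambda>ns. A (\<beta> m ns) = 1) then 1 else 0)"

end

theory Submission
  imports Defs
begin

text \<open>
  Upper bound: bounding the quantifiers one after the other, outermost first, gives the tower,
  because a bounded quantifier stabilises as its bound grows.

  Lower bound: since the limit of an eventually constant sequence can be written both as
  \<open>\<exists>N. \<forall>n. F (N + n) = b\<close> and as \<open>\<forall>N. \<exists>n. F (N + n) = b\<close>, a tower of height less than \<open>m\<close> for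
  \<open>\<Xi>\<^sub>m\<close> turns \<open>\<Xi>\<^sub>m A = 0\<close> into \<open>(Q\<^sub>1 n\<^sub>1) \<dots> (Q\<^sub>m n\<^sub>m). R [n\<^sub>1, \<dots>, n\<^sub>m] A\<close>, where each \<open>R ns A\<close>
  depends on finitely many entries of \<open>A\<close>. Delaying the innermost quantifier makes \<open>R ns A\<close> depend
  only on entries that precede \<open>\<beta>\<^sub>m ns\<close> in an enumeration of the index set, so a matrix \<open>A\<close>
  with \<open>A (\<beta>\<^sub>m ns) = 1 \<longleftrightarrow> R ns A\<close> can be built by recursion. For it, \<open>\<Xi>\<^sub>m A = 1 \<longleftrightarrow> \<Xi>\<^sub>m A = 0\<close>.
\<close>

section \<open>Quantifier prefixes\<close>

lemma Q_const [simp]: "Q k (\<lambda>n. b) = b"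
  by (simp add: Q_def)

text \<open>Unpairing is onto the pairs, so two adjacent quantifiers of the same kind merge into
  one. The universal case is the existential one for the negation.\<close>

lemma Q_prod_decode: "Q k (\<lambda>n. case prod_decode n of (x, y) \<Rightarrow> P x y) = Q k (\<lambda>x. Q k (P x))"
proof -
  have "(\<exists>n. case prod_decode n of (x, y) \<Rightarrow> P x y) = (\<exists>x y. P x y)" for P :: "nat \<Rightarrow> nat \<Rightarrow> bool"
    by (metis (no_types, lifting) case_prod_conv prod_encode_inverse surj_pair)
  from this[of P] this[of "\<lambda>x y. \<not> P x y"] show ?thesis
    by (auto simp: Q_def split_beta)
qed

lemma quantified_cong:
  "(\<And>ns. length ns = m \<Longrightarrow> P ns = P' ns) \<Longrightarrow> quantified k m P = quantified k m P'"
proof (induction m arbitrary: k P P')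
  case (Suc m)
  have "quantified (Suc k) m (\<lambda>ns. P (n # ns)) = quantified (Suc k) m (\<lambda>ns. P' (n # ns))" for n
    by (rule Suc.IH) (simp add: Suc.prems)
  then show ?case by simp
qed simp

section \<open>The discrete metric\<close>

lemma mspace_discrete01 [simp]: "mspace discrete01 = {0, 1}"
  and mdist_discrete01 [simp]: "mdist discrete01 = discrete_metric.dd"
  by (simp_all add: discrete01_def Metric_space.mspace_metric Metric_space.mdist_metric metric_M_dd)

text \<open>The singleton of the limit is an open neighbourhood.\<close>

lemma limitin_discrete01:
  "limitin (mtopology_of discrete01) f l F \<longleftrightarrow> l \<in> {0, 1} \<and> (\<forall>\<^sub>F n in F. f n = l)"
proof -
  interpret discrete_metric "{0, 1 :: nat}" .
  have eq: "mtopology_of discrete01 = discrete_topology {0, 1}"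
    unfolding mtopology_of_def mspace_discrete01 mdist_discrete01 by (rule mtopology_discrete_metric)
  show ?thesis
    unfolding eq limitin_def
    by (auto elim: eventually_mono dest!: spec[of _ "{l}"])
qed

section \<open>Upper bound\<close>

text \<open>The first \<open>length bs\<close> quantifiers are restricted to the bounds in \<open>bs\<close>.\<close>

fun bounded_quantified :: "nat \<Rightarrow> nat \<Rightarrow> nat list \<Rightarrow> (nat list \<Rightarrow> bool) \<Rightarrow> bool" where
  "bounded_quantified k (Suc m) (b # bs) P =
     (if odd k then \<exists>n\<le>b. bounded_quantified (Suc k) m bs (\<lambda>ns. P (n # ns))
      else \<forall>n\<le>b. bounded_quantified (Suc k) m bs (\<lambda>ns. P (n # ns)))"
| "bounded_quantified k m bs P = quantified k m P"

lemma bounded_quantified_Nil [simp]: "bounded_quantified k m [] P = quantified k m P"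
  by (cases m) auto

lemma eventually_bounded_Ex: "\<forall>\<^sub>F b in sequentially. (\<exists>n\<le>b. P n) \<longleftrightarrow> (\<exists>n. P n)"
proof (cases "\<exists>n. P n")
  case True
  then obtain n where "P n" by blast
  then have "\<forall>b\<ge>n. (\<exists>n\<le>b. P n) \<longleftrightarrow> (\<exists>n. P n)" by blast
  then show ?thesis by (auto simp: eventually_sequentially)
qed simp

lemma eventually_bounded_All: "\<forall>\<^sub>F b in sequentially. (\<forall>n\<le>b. P n) \<longleftrightarrow> (\<forall>n. P n)"
  using eventually_bounded_Ex[of "\<lambda>n. \<not> P n"] by (rule eventually_mono) blast

text \<open>The quantifiers already bounded by \<open>bs\<close> range over finitely many values, so
  finitely many eventual equalities hold from a common index on.\<close>

lemma eventually_bounded_quantified: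
  "length bs < m \<Longrightarrow>
    \<forall>\<^sub>F n in sequentially. bounded_quantified k m (bs @ [n]) P = bounded_quantified k m bs P"
proof (induction bs arbitrary: k m P)
  case Nil
  then obtain m' where m: "m = Suc m'" by (cases m) auto
  show ?case
    using eventually_bounded_Ex eventually_bounded_All by (simp add: m Q_def)
next
  case (Cons b bs)
  then obtain m' where m: "m = Suc m'" and len: "length bs < m'" by (cases m) auto
  have "\<forall>\<^sub>F n in sequentially. \<forall>x\<in>{..b}.
      bounded_quantified (Suc k) m' (bs @ [n]) (\<lambda>ns. P (x # ns)) =
      bounded_quantified (Suc k) m' bs (\<lambda>ns. P (x # ns))"
    by (intro eventually_ball_finite ballI Cons.IH len) simp
  then show ?case
    by (rule eventually_mono) (auto simp: m)
qed

text \<open>With every quantifier bounded only finitely many tuples occur, and which ones depends on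
  the bounds alone; hence one \<open>S\<close> serves all \<open>P\<close> and
  \<open>P'\<close>.\<close>

lemma bounded_quantified_finite_support:
  "length bs = m \<Longrightarrow> \<exists>S. finite S \<and>
     (\<forall>P P'. (\<forall>ns\<in>S. P ns = P' ns) \<longrightarrow> bounded_quantified k m bs P = bounded_quantified k m bs P')"
proof (induction bs arbitrary: k m)
  case Nil
  then show ?case by (intro exI[of _ "{[]}"]) auto
next
  case (Cons b bs)
  then obtain m' where m: "m = Suc m'" and len: "length bs = m'" by auto
  from Cons.IH[OF len, of "Suc k"] obtain S where S: "finite S"
    "\<And>P P'. (\<forall>ns\<in>S. P ns = P' ns) \<Longrightarrow>
       bounded_quantified (Suc k) m' bs P = bounded_quantified (Suc k) m' bs P'"
    by blast
  let ?S = "(\<lambda>(n, ns). n # ns) ` ({..b} \<times> S)"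
  have "bounded_quantified k m (b # bs) P = bounded_quantified k m (b # bs) P'"
    if "\<forall>ns\<in>?S. P ns = P' ns" for P P'
  proof -
    have "bounded_quantified (Suc k) m' bs (\<lambda>ns. P (n # ns)) =
        bounded_quantified (Suc k) m' bs (\<lambda>ns. P' (n # ns))" if "n \<le> b" for n
      using \<open>\<forall>ns\<in>?S. P ns = P' ns\<close> that by (intro S(2)) auto
    then show ?thesis by (auto simp: m)
  qed
  moreover have "finite ?S"
    using S(1) by simp
  ultimately show ?case by blast
qed

text \<open>A query set that does not vary with the input satisfies the consistency condition
  trivially.\<close>

lemma general_algorithm_finite_support:
  assumes "\<And>A. A \<in> \<Omega> \<Longrightarrow> \<Gamma> A \<in> mspace M" and "finite L" "L \<noteq> {}" "L \<subseteq> \<Lambda>"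
    and "\<And>A B. A \<in> \<Omega> \<Longrightarrow> B \<in> \<Omega> \<Longrightarrow> (\<forall>f\<in>L. f B = f A) \<Longrightarrow> \<Gamma> B = \<Gamma> A"
  shows "general_algorithm \<Omega> M \<Lambda> \<Gamma>"
  unfolding general_algorithm_def
  using assms by (intro conjI ballI impI exI[of _ "\<lambda>_. L"]) blast+

lemma Lambda_mat_eq: "Lambda_mat = range (\<lambda>p A. A p)"
  by (auto simp: Lambda_mat_def)

lemma tower_Xi:
  "tower (Xi \<beta> m) Omega1 discrete01 Lambda_mat m
     (\<lambda>bs A. of_bool (bounded_quantified 1 m bs (\<lambda>ns. A (\<beta> m ns) = 1)))"
  (is "tower _ _ _ _ _ ?\<Gamma>")
  unfolding tower_def
proof (intro conjI allI impI ballI)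
  fix bs :: "nat list"
  assume "length bs = m"
  then obtain S where S: "finite S"
    "\<And>P P'. (\<forall>ns\<in>S. P ns = P' ns) \<Longrightarrow> bounded_quantified 1 m bs P = bounded_quantified 1 m bs P'"
    using bounded_quantified_finite_support[of bs m 1] by blast
  show "general_algorithm Omega1 discrete01 Lambda_mat (?\<Gamma> bs)"
  proof (rule general_algorithm_finite_support)
    \<comment> \<open>The extra position \<open>(0, 0)\<close> keeps the query set nonempty whatever
      \<open>S\<close> is.\<close>
    let ?L = "(\<lambda>p A. A p) ` insert (0, 0) (\<beta> m ` S) :: ((nat \<times> nat \<Rightarrow> nat) \<Rightarrow> nat) set"
    show "finite ?L" "?L \<noteq> {}" "?L \<subseteq> Lambda_mat"
      using S(1) by (auto simp: Lambda_mat_eq)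
    show "?\<Gamma> bs B = ?\<Gamma> bs A" if "\<forall>f\<in>?L. f B = f A" for A B
    proof -
      from that have "\<forall>ns\<in>S. (B (\<beta> m ns) = 1) = (A (\<beta> m ns) = 1)" by simp
      from S(2)[OF this] show ?thesis by simp
    qed
  qed simp
next
  fix bs :: "nat list" and A
  assume "length bs < m"
  from eventually_bounded_quantified[OF this]
  have "\<forall>\<^sub>F n in sequentially. ?\<Gamma> (bs @ [n]) A = ?\<Gamma> bs A"
    by (rule eventually_mono) (rule arg_cong[where f = of_bool])
  then show "limitin (mtopology_of discrete01) (\<lambda>n. ?\<Gamma> (bs @ [n]) A) (?\<Gamma> bs A) sequentially"
    unfolding limitin_discrete01 by simp
qed (simp add: Xi_def)

section \<open>Lower bound\<close>

text \<open>This is continuity of \<open>S\<close> into the discrete two-point space, for the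
  topology on \<open>\<Omega>\<close> induced by \<open>\<Lambda>\<close> with discrete
  values.\<close>

definition locally_determined :: "'a set \<Rightarrow> ('a \<Rightarrow> 'v) set \<Rightarrow> ('a \<Rightarrow> bool) \<Rightarrow> bool" where
  "locally_determined \<Omega> \<Lambda> S \<longleftrightarrow>
     (\<forall>A\<in>\<Omega>. \<exists>L. finite L \<and> L \<subseteq> \<Lambda> \<and> (\<forall>B\<in>\<Omega>. (\<forall>f\<in>L. f B = f A) \<longrightarrow> S B = S A))"

text \<open>The analogue of the Borel class \<open>\<Sigma>\<^sub>m\<close> for odd \<open>k\<close> and of \<open>\<Pi>\<^sub>m\<close> for even \<open>k\<close>.\<close>

primrec quantifier_class ::
  "'a set \<Rightarrow> ('a \<Rightarrow> 'v) set \<Rightarrow> nat \<Rightarrow> nat \<Rightarrow> ('a \<Rightarrow> bool) \<Rightarrow> bool" where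
  "quantifier_class \<Omega> \<Lambda> k 0 S = locally_determined \<Omega> \<Lambda> S"
| "quantifier_class \<Omega> \<Lambda> k (Suc m) S =
     (\<exists>T. (\<forall>n. quantifier_class \<Omega> \<Lambda> (Suc k) m (T n)) \<and> (\<forall>A\<in>\<Omega>. S A = Q k (\<lambda>n. T n A)))"

lemma quantifier_class_SucI:
  "(\<And>n. quantifier_class \<Omega> \<Lambda> (Suc k) m (T n)) \<Longrightarrow> (\<And>A. A \<in> \<Omega> \<Longrightarrow> S A = Q k (\<lambda>n. T n A)) \<Longrightarrow>
    quantifier_class \<Omega> \<Lambda> k (Suc m) S"
  by auto

text \<open>The extra quantifier is vacuous and sits innermost, so the alternation of the given
  prefix is untouched.\<close>

lemma quantifier_class_dummy:
  "quantifier_class \<Omega> \<Lambda> k m S \<Longrightarrow> quantifier_class \<Omega> \<Lambda> k (Suc m) S"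
proof (induction m arbitrary: k S)
  case 0
  then show ?case by (intro quantifier_class_SucI[where T = "\<lambda>_. S"]) auto
next
  case (Suc m)
  from Suc.prems obtain T where T: "\<And>n. quantifier_class \<Omega> \<Lambda> (Suc k) m (T n)"
    "\<And>A. A \<in> \<Omega> \<Longrightarrow> S A = Q k (\<lambda>n. T n A)"
    by auto
  show ?case
    using Suc.IH[OF T(1)] T(2) by (rule quantifier_class_SucI)
qed

lemma quantifier_class_mono:
  assumes "quantifier_class \<Omega> \<Lambda> k m S" "m \<le> m'"
  shows "quantifier_class \<Omega> \<Lambda> k m' S"
  using assms(2,1)
  by (induction rule: dec_induct) (blast intro: quantifier_class_dummy)+

text \<open>The counterpart of closure under countable unions or intersections: the new quantifier
  has the kind of the leading one of each \<open>S n\<close>, and pairing merges the two.\<close>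

lemma quantifier_class_Q:
  assumes "\<And>n. quantifier_class \<Omega> \<Lambda> k (Suc m) (S n)"
  shows "quantifier_class \<Omega> \<Lambda> k (Suc m) (\<lambda>A. Q k (\<lambda>n. S n A))"
proof -
  have "\<forall>n. \<exists>T. (\<forall>x. quantifier_class \<Omega> \<Lambda> (Suc k) m (T x)) \<and>
      (\<forall>A\<in>\<Omega>. S n A = Q k (\<lambda>x. T x A))"
    using assms by simp
  from choice[OF this] obtain T where
    T: "\<And>n x. quantifier_class \<Omega> \<Lambda> (Suc k) m (T n x)"
      "\<And>n A. A \<in> \<Omega> \<Longrightarrow> S n A = Q k (\<lambda>x. T n x A)"
    by blast
  show ?thesis
  proof (rule quantifier_class_SucI)
    show "quantifier_class \<Omega> \<Lambda> (Suc k) m (case prod_decode n of (x, y) \<Rightarrow> T x y)" for n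
      by (simp add: T(1) split: prod.split)
    show "Q k (\<lambda>n. S n A) = Q k (\<lambda>n. (case prod_decode n of (x, y) \<Rightarrow> T x y) A)"
      if "A \<in> \<Omega>" for A
      using Q_prod_decode[of k "\<lambda>x y. T x y A"] T(2)[OF that] by (simp add: split_beta)
  qed
qed

text \<open>For an eventually constant sequence, taking the value \<open>b\<close> eventually and
  taking it infinitely often are the same. The parity of \<open>k\<close> decides which form is
  used.\<close>

lemma eventually_eq_iff_Q:
  assumes "\<forall>\<^sub>F n in sequentially. F n = l"
  shows "l = b \<longleftrightarrow> Q k (\<lambda>N. Q (Suc k) (\<lambda>n. F (N + n) = b))"
proof -
  from assms obtain N0 where N0: "\<And>n. n \<ge> N0 \<Longrightarrow> F n = l"
    by (auto simp: eventually_sequentially)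
  have "l = b" if "\<forall>n. F (N + n) = b" for N
    using that N0[of "N + N0"] by simp
  moreover have "l = b" if "\<forall>N. \<exists>n. F (N + n) = b"
  proof -
    from that obtain n where "F (N0 + n) = b" by blast
    with N0[of "N0 + n"] show ?thesis by simp
  qed
  moreover have "\<forall>n. F (N0 + n) = l" using N0 by simp
  moreover have "\<forall>N. \<exists>n. F (N + n) = l"
    using N0 by (metis le_add2)
  ultimately show ?thesis
    by (auto simp: Q_def)
qed

lemma general_algorithm_imp_locally_determined:
  "general_algorithm \<Omega> M \<Lambda> \<Gamma> \<Longrightarrow> locally_determined \<Omega> \<Lambda> (\<lambda>A. \<Gamma> A = b)"
  unfolding general_algorithm_def locally_determined_def by metis

text \<open>One limit costs the quantifiers \<open>Q k\<close> and \<open>Q (Suc k)\<close>, but the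
  second merges with the leading quantifier of the class obtained for the inner limits. Thus each
  limit adds only one quantifier.\<close>

lemma tower_quantifier_class:
  assumes "tower \<Xi> \<Omega> discrete01 \<Lambda> d \<Gamma>"
  shows "length ns + j = d \<Longrightarrow> quantifier_class \<Omega> \<Lambda> k (Suc j) (\<lambda>A. \<Gamma> ns A = b)"
proof (induction j arbitrary: ns k)
  case 0
  then have "locally_determined \<Omega> \<Lambda> (\<lambda>A. \<Gamma> ns A = b)"
    using assms by (auto simp: tower_def intro: general_algorithm_imp_locally_determined)
  \<comment> \<open>A vacuous quantifier gives the merging in the induction step something to absorb
    into; it accounts for \<open>Suc j\<close> in place of \<open>j\<close>.\<close>
  then show ?case
    by (intro quantifier_class_dummy) simp
next
  case (Suc j)
  have lim: "\<forall>\<^sub>F n in sequentially. \<Gamma> (ns @ [n]) A = \<Gamma> ns A" if "A \<in> \<Omega>" for A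
    using assms Suc.prems that by (auto simp: tower_def limitin_discrete01)
  show ?case
  proof (rule quantifier_class_SucI)
    show "quantifier_class \<Omega> \<Lambda> (Suc k) (Suc j) (\<lambda>A. Q (Suc k) (\<lambda>n. \<Gamma> (ns @ [N + n]) A = b))" for N
      using Suc.prems by (intro quantifier_class_Q Suc.IH) simp
    show "(\<Gamma> ns A = b) = Q k (\<lambda>N. Q (Suc k) (\<lambda>n. \<Gamma> (ns @ [N + n]) A = b))" if "A \<in> \<Omega>" for A
      using lim[OF that] by (rule eventually_eq_iff_Q)
  qed
qed

section \<open>Delaying the innermost quantifier\<close>

definition agree_below :: "('p \<Rightarrow> nat) \<Rightarrow> nat \<Rightarrow> ('p \<Rightarrow> 'v) \<Rightarrow> ('p \<Rightarrow> 'v) \<Rightarrow> bool" where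
  "agree_below c n A B \<longleftrightarrow> (\<forall>p. c p < n \<longrightarrow> A p = B p)"

lemma agree_below_refl [simp]: "agree_below c n A A"
  and agree_below_sym: "agree_below c n A B \<Longrightarrow> agree_below c n B A"
  and agree_below_trans: "agree_below c n A B \<Longrightarrow> agree_below c n B C \<Longrightarrow> agree_below c n A C"
  by (auto simp: agree_below_def)

text \<open>Finitely many positions decide \<open>S\<close> near \<open>A\<close>, and their codes
  have a common bound.\<close>

lemma locally_determined_agree_below:
  assumes "locally_determined \<Omega> (range (\<lambda>p A. A p)) S" "A \<in> \<Omega>"
  obtains K where "\<And>n B. n \<ge> K \<Longrightarrow> B \<in> \<Omega> \<Longrightarrow> agree_below c n A B \<Longrightarrow> S B = S A"
proof -
  from assms obtain L where L: "finite L" "L \<subseteq> range (\<lambda>p A. A p)"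
    "\<And>B. B \<in> \<Omega> \<Longrightarrow> (\<forall>f\<in>L. f B = f A) \<Longrightarrow> S B = S A"
    unfolding locally_determined_def by metis
  from finite_subset_image[OF L(1,2)] obtain I where I: "finite I" "L = (\<lambda>p A. A p) ` I"
    by blast
  from I(1) obtain K where K: "\<And>p. p \<in> I \<Longrightarrow> c p < K"
    using finite_nat_set_iff_bounded[of "c ` I"] by auto
  show thesis
  proof (rule that)
    fix n B
    assume "n \<ge> K" "B \<in> \<Omega>" "agree_below c n A B"
    then show "S B = S A"
      using K by (intro L(3)) (fastforce simp: I(2) agree_below_def)+
  qed
qed

text \<open>
  \<open>R n\<close> waits until one of the candidates \<open>t \<le> n\<close> has been confirmed by the entries of code less
  than \<open>w n\<close>; this happens eventually because \<open>T t\<close> is locally determined and \<open>w\<close> is unbounded.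
\<close>

lemma delayed_Ex:
  fixes c :: "'p \<Rightarrow> nat" and T :: "nat \<Rightarrow> ('p \<Rightarrow> 'v) \<Rightarrow> bool"
  assumes T: "\<And>n. locally_determined \<Omega> (range (\<lambda>p A. A p)) (T n)"
    and w: "filterlim w at_top sequentially"
  shows "\<exists>R. (\<forall>n A B. agree_below c (w n) A B \<longrightarrow> R n A = R n B) \<and>
    (\<forall>A\<in>\<Omega>. (\<exists>n. T n A) = (\<exists>n. R n A))"
proof (intro exI conjI allI impI ballI)
  define R where "R n A = (\<exists>t\<le>n. \<forall>B\<in>\<Omega>. agree_below c (w n) A B \<longrightarrow> T t B)" for n :: nat and A
  show "R n A = R n B" if "agree_below c (w n) A B" for n A B
    unfolding R_def using that by (meson agree_below_sym agree_below_trans)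
  show "(\<exists>n. T n A) = (\<exists>n. R n A)" if A: "A \<in> \<Omega>" for A
  proof
    assume "\<exists>n. T n A"
    then obtain t where t: "T t A" by blast
    from locally_determined_agree_below[OF T A] obtain K where
      K: "\<And>n B. n \<ge> K \<Longrightarrow> B \<in> \<Omega> \<Longrightarrow> agree_below c n A B \<Longrightarrow> T t B = T t A"
      by metis
    \<comment> \<open>The window \<open>w n\<close> must reach past \<open>K\<close> while
      \<open>t\<close> is still a candidate. Admitting all \<open>t \<le> n\<close> lets
      \<open>t\<close> be confirmed at a later index.\<close>
    have "\<forall>\<^sub>F n in sequentially. K \<le> w n \<and> t \<le> n"
      using w by (intro eventually_conj eventually_ge_at_top) (simp add: filterlim_at_top)
    then obtain n where "K \<le> w n" "t \<le> n"
      by (metis (mono_tags, lifting) eventually_happens' sequentially_bot)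
    with K t show "\<exists>n. R n A" unfolding R_def by blast
  next
    assume "\<exists>n. R n A"
    with A show "\<exists>n. T n A" unfolding R_def by auto
  qed
qed

text \<open>Local determination is closed under negation, so the universal case follows by
  complementing \<open>T\<close> and \<open>R\<close>.\<close>

lemma delayed_Q:
  fixes c :: "'p \<Rightarrow> nat"
  assumes T: "\<And>n. locally_determined \<Omega> (range (\<lambda>p A. A p)) (T n)"
    and w: "filterlim w at_top sequentially"
  shows "\<exists>R. (\<forall>n A B. agree_below c (w n) A B \<longrightarrow> R n A = R n B) \<and>
    (\<forall>A\<in>\<Omega>. Q k (\<lambda>n. T n A) = Q k (\<lambda>n. R n A))"
proof (cases "odd k")
  case True
  then show ?thesis using delayed_Ex[OF T w] by (simp add: Q_def)
next
  case False
  have "locally_determined \<Omega> (range (\<lambda>p A. A p)) (\<lambda>A. \<not> T n A)" for n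
    using T[of n] by (simp add: locally_determined_def)
  from delayed_Ex[where T = "\<lambda>n A. \<not> T n A" and c = c, OF this w] obtain R where
    "\<forall>n A B. agree_below c (w n) A B \<longrightarrow> R n A = R n B"
    "\<forall>A\<in>\<Omega>. (\<exists>n. \<not> T n A) = (\<exists>n. R n A)"
    by blast
  with False show ?thesis
    by (intro exI[of _ "\<lambda>n A. \<not> R n A"]) (auto simp: Q_def)
qed

text \<open>Only the innermost quantifier is delayed. The outer indices are carried along as fixed
  parameters, which is why \<open>w\<close> is to diverge in the last index.\<close>

lemma quantifier_class_delayed:
  fixes c :: "'p \<Rightarrow> nat"
  assumes "quantifier_class \<Omega> (range (\<lambda>p A. A p)) k (Suc m) S"
    and "\<And>ns. length ns = m \<Longrightarrow> filterlim (\<lambda>n. w (ns @ [n])) at_top sequentially"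
  shows "\<exists>R. (\<forall>ns A B. length ns = Suc m \<longrightarrow> agree_below c (w ns) A B \<longrightarrow> R ns A = R ns B) \<and>
    (\<forall>A\<in>\<Omega>. S A = quantified k (Suc m) (\<lambda>ns. R ns A))"
  using assms
proof (induction m arbitrary: k S w)
  case 0
  from "0.prems"(1) obtain T where T: "\<And>n. locally_determined \<Omega> (range (\<lambda>p A. A p)) (T n)"
    "\<And>A. A \<in> \<Omega> \<Longrightarrow> S A = Q k (\<lambda>n. T n A)"
    by auto
  have "filterlim (\<lambda>n. w [n]) at_top sequentially"
    using "0.prems"(2)[of "[]"] by simp
  from delayed_Q[where T = T and c = c and k = k, OF T(1) this] obtain R where R:
    "\<forall>n A B. agree_below c (w [n]) A B \<longrightarrow> R n A = R n B"
    "\<forall>A\<in>\<Omega>. Q k (\<lambda>n. T n A) = Q k (\<lambda>n. R n A)"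
    by blast
  show ?case
    using R T(2) by (intro exI[of _ "\<lambda>ns. R (hd ns)"]) (auto simp: length_Suc_conv)
next
  case (Suc m)
  from Suc.prems(1) obtain T where
    T: "\<And>n. quantifier_class \<Omega> (range (\<lambda>p A. A p)) (Suc k) (Suc m) (T n)"
      "\<And>A. A \<in> \<Omega> \<Longrightarrow> S A = Q k (\<lambda>n. T n A)"
    by (subst (asm) quantifier_class.simps) blast
  have "\<forall>n. \<exists>R. (\<forall>ns A B. length ns = Suc m \<longrightarrow>
        agree_below c (w (n # ns)) A B \<longrightarrow> R ns A = R ns B) \<and>
      (\<forall>A\<in>\<Omega>. T n A = quantified (Suc k) (Suc m) (\<lambda>ns. R ns A))"
  proof
    fix n
    have "filterlim (\<lambda>n'. w (n # ns @ [n'])) at_top sequentially" if "length ns = m" for ns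
      using Suc.prems(2)[of "n # ns"] that by simp
    from Suc.IH[OF T(1)[of n], of "\<lambda>ns. w (n # ns)", OF this]
    show "\<exists>R. (\<forall>ns A B. length ns = Suc m \<longrightarrow>
        agree_below c (w (n # ns)) A B \<longrightarrow> R ns A = R ns B) \<and>
      (\<forall>A\<in>\<Omega>. T n A = quantified (Suc k) (Suc m) (\<lambda>ns. R ns A))" .
  qed
  from choice[OF this] obtain R where R':
    "\<forall>n. (\<forall>ns A B. length ns = Suc m \<longrightarrow> agree_below c (w (n # ns)) A B \<longrightarrow>
        R n ns A = R n ns B) \<and>
      (\<forall>A\<in>\<Omega>. T n A = quantified (Suc k) (Suc m) (\<lambda>ns. R n ns A))"
    by blast
  have R:
    "length ns = Suc m \<Longrightarrow> agree_below c (w (n # ns)) A B \<Longrightarrow> R n ns A = R n ns B"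
    "A \<in> \<Omega> \<Longrightarrow> T n A = quantified (Suc k) (Suc m) (\<lambda>ns. R n ns A)" for n ns A B
    using R'[rule_format, of n] by blast+
  show ?case
  proof (intro exI[of _ "\<lambda>ns. R (hd ns) (tl ns)"] conjI allI impI ballI)
    show "R (hd ns) (tl ns) A = R (hd ns) (tl ns) B"
      if "length ns = Suc (Suc m)" "agree_below c (w ns) A B" for ns A B
      using that by (intro R(1)) (auto simp: length_Suc_conv)
    show "S A = quantified k (Suc (Suc m)) (\<lambda>ns. R (hd ns) (tl ns) A)" if "A \<in> \<Omega>" for A
      using T(2)[OF that] R(2)[OF that] by simp
  qed
qed

section \<open>The diagonal matrix\<close>

text \<open>The entry of \<open>g A\<close> at \<open>p\<close> depends only on entries of strictly
  smaller code, so each application of \<open>g\<close> settles one more code and the iterates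
  converge pointwise.\<close>

lemma causal_fixed_point:
  fixes c :: "'p \<Rightarrow> nat" and g :: "('p \<Rightarrow> 'v) \<Rightarrow> 'p \<Rightarrow> 'v"
  assumes causal: "\<And>p A B. agree_below c (c p) A B \<Longrightarrow> g A p = g B p"
  obtains A where "g A = A"
proof -
  \<comment> \<open>The starting point is arbitrary.\<close>
  let ?A = "\<lambda>n. (g ^^ n) undefined"
  have agree: "agree_below c n (?A (n + d)) (?A n)" for n d
  proof (induction n)
    case (Suc n)
    show ?case
      unfolding agree_below_def
    proof (intro allI impI)
      fix p
      assume "c p < Suc n"
      then have "agree_below c (c p) (?A (n + d)) (?A n)"
        using Suc by (auto simp: agree_below_def)
      from causal[OF this] show "?A (Suc n + d) p = ?A (Suc n) p" by simp
    qed
  qed (simp add: agree_below_def)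
  \<comment> \<open>Stage \<open>n\<close> is settled on codes below \<open>n\<close>, so
    \<open>Suc (c p)\<close> is the first stage that covers \<open>p\<close>.\<close>
  define A where "A p = ?A (Suc (c p)) p" for p
  have "agree_below c n A (?A n)" for n
    unfolding agree_below_def
  proof (intro allI impI)
    fix p
    assume "c p < n"
    then obtain d where "n = Suc (c p) + d" using less_iff_Suc_add by auto
    with agree[of "Suc (c p)" d] show "A p = ?A n p"
      by (auto simp: A_def agree_below_def)
  qed
  \<comment> \<open>At \<open>n = c p\<close> causality replaces \<open>A\<close> by the iterate of
    stage \<open>c p\<close>; applying \<open>g\<close> once more gives the stage that defines
    \<open>A p\<close>.\<close>
  from causal[OF this] have "g A p = A p" for p
    by (simp add: A_def)
  then show thesis by (intro that ext)
qed

lemma Xi_tower_height: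
  assumes bij: "bij_betw (\<beta> m) {ns. length ns = m} UNIV" and "m \<ge> 1"
    and tower: "tower (Xi \<beta> m) Omega1 discrete01 Lambda_mat d \<Gamma>"
  shows "m \<le> d"
proof (rule ccontr)
  assume "\<not> m \<le> d"
  then have d: "Suc d \<le> m" by simp
  obtain m' where m: "m = Suc m'" using \<open>m \<ge> 1\<close> by (cases m) auto
  \<comment> \<open>The value 0 is taken so that the complement of \<open>\<Xi>\<^sub>m\<close>
    receives a prefix of the same shape as the one defining \<open>\<Xi>\<^sub>m\<close>.\<close>
  have "quantifier_class Omega1 Lambda_mat 1 m (\<lambda>A. \<Gamma> [] A = 0)"
    using tower_quantifier_class[OF tower] d by (intro quantifier_class_mono[OF _ d]) simp
  then have qc: "quantifier_class Omega1 (range (\<lambda>p A. A p)) 1 (Suc m') (\<lambda>A. \<Gamma> [] A = 0)"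
    by (simp only: m Lambda_mat_eq)
  let ?w = "\<lambda>ns. prod_encode (\<beta> m ns)"
  have "filterlim (\<lambda>n. ?w (ns @ [n])) at_top sequentially" if "length ns = m'" for ns
  proof -
    \<comment> \<open>Distinct last indices give distinct codes, and an injective sequence of
      naturals tends to infinity.\<close>
    have "inj (\<lambda>n. ?w (ns @ [n]))"
      using that inj_onD[OF bij_betw_imp_inj_on[OF bij]] by (fastforce intro!: injI simp: m)
    then have "finite {n. ?w (ns @ [n]) < K}" for K
      using finite_vimageI[of "{..<K}"] by (simp add: vimage_def)
    then show ?thesis
      unfolding filterlim_at_top
      by (simp add: cofinite_eq_sequentially[symmetric] eventually_cofinite not_le)
  qed
  from quantifier_class_delayed[OF qc this, of prod_encode] obtain R where R:
    "\<And>ns A B. length ns = m \<Longrightarrow> agree_below prod_encode (?w ns) A B \<Longrightarrow> R ns A = R ns B"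
    "\<And>A. A \<in> Omega1 \<Longrightarrow> (\<Gamma> [] A = 0) = quantified 1 m (\<lambda>ns. R ns A)"
    unfolding m by blast
  let ?inv = "inv_into {ns. length ns = m} (\<beta> m)"
  have inv: "length (?inv p) = m" "\<beta> m (?inv p) = p" for p
    using bij_betw_inv_into_right[OF bij, of p] bij_betwE[OF bij_betw_inv_into[OF bij]] by blast+
  have "of_bool (R (?inv p) A) = of_bool (R (?inv p) B)"
    if "agree_below prod_encode (prod_encode p) A B" for p A B
    using R(1)[OF inv(1), of p A B] that by (simp add: inv(2))
  \<comment> \<open>The entry at \<open>p\<close> is to be the truth value of \<open>R\<close> at
    the tuple of \<open>p\<close>, which reads only entries of code below that of \<open>p\<close>:
    the self-reference is causal.\<close>
  then obtain A :: "nat \<times> nat \<Rightarrow> nat" where A: "(\<lambda>p. of_bool (R (?inv p) A)) = A"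
    by (rule causal_fixed_point)
  have Omega: "A \<in> Omega1"
    by (subst A[symmetric]) (simp add: Omega1_def)
  have "(A (\<beta> m ns) = 1) = R ns A" if "length ns = m" for ns
    using fun_cong[OF A, of "\<beta> m ns"] that bij_betw_inv_into_left[OF bij, of ns]
    by (auto simp: of_bool_def split: if_splits)
  then have "quantified 1 m (\<lambda>ns. A (\<beta> m ns) = 1) = quantified 1 m (\<lambda>ns. R ns A)"
    by (rule quantified_cong)
  also have "\<dots> = (Xi \<beta> m A = 0)"
    using R(2)[OF Omega] tower Omega by (simp add: tower_def)
  finally show False by (simp add: Xi_def split: if_splits)
qed

theorem theoremE7:
  fixes \<beta> :: "nat \<Rightarrow> nat list \<Rightarrow> nat \<times> nat"
  assumes "\<And>m. m \<ge> 1 \<Longrightarrow> bij_betw (\<beta> m) {ns. length ns = m} UNIV"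
  shows "\<forall>m\<ge>1.
           (Xi \<beta> m, Omega1, discrete01, Lambda_mat) \<notin> Delta_G (m - 1) \<and>
           SCI_G (Xi \<beta> m) Omega1 discrete01 Lambda_mat \<ge> enat m \<and>
           SCI_G (Xi \<beta> m) Omega1 discrete01 Lambda_mat = enat m"
proof (intro allI impI)
  fix m :: nat
  assume m: "m \<ge> 1"
  have "SCI_G (Xi \<beta> m) Omega1 discrete01 Lambda_mat = enat m"
    unfolding SCI_G_def
  proof (rule antisym)
    show "Inf {enat k | k. \<exists>\<Gamma>. tower (Xi \<beta> m) Omega1 discrete01 Lambda_mat k \<Gamma>} \<le> enat m"
      using tower_Xi by (intro Inf_lower) blast
    show "enat m \<le> Inf {enat k | k. \<exists>\<Gamma>. tower (Xi \<beta> m) Omega1 discrete01 Lambda_mat k \<Gamma>}"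
      using Xi_tower_height[where \<beta> = \<beta> and m = m, OF assms[OF m] m] by (intro Inf_greatest) auto
  qed
  then show "(Xi \<beta> m, Omega1, discrete01, Lambda_mat) \<notin> Delta_G (m - 1) \<and>
      SCI_G (Xi \<beta> m) Omega1 discrete01 Lambda_mat \<ge> enat m \<and>
      SCI_G (Xi \<beta> m) Omega1 discrete01 Lambda_mat = enat m"
    \<comment> \<open>Here \<open>m \<ge> 1\<close> ensures that the truncated difference
      \<open>m - 1\<close> is strictly below \<open>m\<close>.\<close>
    using m by (simp add: Delta_G_def)
qed

end
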